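(* Let $A,M,B,R,P_*$ be as in the context, and suppose that $\|I-M^{-1}A\|_B<1$, that $I-\widehat M^{-1}B$ is nonsingular, and that $\Pi_A(P_*,R)$ is a $B$-orthogonal projection with $0<\dim\mathcal R(\Pi_A(P_*,R))=n_c<n$. Then $$\|E_+^{1,1}\|_B=\|E_+^{1,0}\|_B^2=\|E_+^{0,1}\|_B^2=1-\frac1{K_{\widehat M,B}(P_* )}$$ with $1/K_{\widehat M,B}(P_* )\in(0,1)$.
   Context: $A\in\mathbb{C}^{n\times n}$ is nonsingular, $M^{-1}\in\mathbb{C}^{n\times n}$ is nonsingular, and $B\in\mathbb{C}^{n\times n}$ is Hermitian positive definite (HPD). $\|x\|_B=\sqrt{x^HBx}$ and $\|C\|_B=\sup_{x\ne0}\|Cx\|_B/\|x\|_B$. The $B$-adjoint of $C\in\mathbb{C}^{n\times n}$ is $C^+=B^{-1}C^HB$; $C$ is $B$-orthogonal if $C^+=C$. $\mathcal R(\cdot)$ denotes the range. $R\in\mathbb{C}^{n\times n_c}$ has full column rank and $P_*=B^{-1}A^HR$. $\Pi_A(P_*,R)=P_*(R^HAP_* )^{-1}R^HA$. The error propagation matrices are, for $\nu_1,\nu_2\in\mathbb{N}_0$, $$E_+^{\nu_1,\nu_2}=(I-(M^{-1}A)^+)^{\nu_2}(I-\Pi_A(P_*,R))(I-M^{-1}A)^{\nu_1}.$$ The matrix $\widehat M^{-1}$ is defined by $\widehat M^{-1}=M^{-1}AB^{-1}+B^{-1}A^HM^{-H}-M^{-1}AB^{-1}A^HM^{-H}$,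 so that $I-\widehat M^{-1}B=(I-M^{-1}A)(I-M^{-1}A)^+$; when $\|I-M^{-1}A\|_B<1$ it is HPD, and $\widehat M$ denotes its inverse. For HPD matrices $G,C\in\mathbb{C}^{n\times n}$ and $P\in\mathbb{C}^{n\times n_c}$ of full column rank, $$K_{G,C}(P)=\max_{v\in\mathbb{C}^n\setminus\{0\}}\frac{v^HG\bigl(I-P(P^HGP)^{-1}P^HG\bigr)v}{v^HCv}.$$ *)

theory Defs
  imports "HOL-Analysis.Analysis"
begin

definition ctranspose :: "complex^'n^'m \<Rightarrow> complex^'m^'n"  ("(_\<^sup>H)" [1000] 999)
  where "A\<^sup>H = map_matrix cnj (transpose A)"

text \<open>The value $x^H C y$; the inner product of the library on \<^typ>\<open>complex^'n\<close> is only its real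
  part (for $C = I$).\<close>

definition sesq :: "complex^'n \<Rightarrow> complex^'m^'n \<Rightarrow> complex^'m \<Rightarrow> complex"
  where "sesq x C y = (\<Sum>i\<in>UNIV. cnj (x $ i) * (C *v y) $ i)"

text \<open>For a Hermitian matrix $x^H B x$ is a real number, so that \<^const>\<open>Re\<close> below (and in the
  definitions that follow) discards nothing.\<close>

definition hpd :: "complex^'n^'n \<Rightarrow> bool"
  where "hpd B \<longleftrightarrow> B\<^sup>H = B \<and> (\<forall>x. x \<noteq> 0 \<longrightarrow> Re (sesq x B x) > 0)"

definition vnorm :: "complex^'n^'n \<Rightarrow> complex^'n \<Rightarrow> real"
  where "vnorm B x = sqrt (Re (sesq x B x))"

definition mnorm :: "complex^'n^'n \<Rightarrow> complex^'n^'n \<Rightarrow> real"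
  where "mnorm B C = (SUP x\<in>{x. x \<noteq> 0}. vnorm B (C *v x) / vnorm B x)"

definition badjoint :: "complex^'n^'n \<Rightarrow> complex^'n^'n \<Rightarrow> complex^'n^'n"
  where "badjoint B C = matrix_inv B ** C\<^sup>H ** B"

definition b_orthogonal :: "complex^'n^'n \<Rightarrow> complex^'n^'n \<Rightarrow> bool"
  where "b_orthogonal B C \<longleftrightarrow> badjoint B C = C"

definition projection :: "complex^'n^'n \<Rightarrow> bool"
  where "projection C \<longleftrightarrow> C ** C = C"

text \<open>The dimension over the complex numbers; the library's \<^const>\<open>dim\<close> is the real one.\<close>

definition range_dim :: "complex^'n^'n \<Rightarrow> nat"
  where "range_dim C = vec.dim (range (\<lambda>x. C *v x))"

text \<open>The power operation of the library on \<^typ>\<open>complex^'n^'n\<close> is componentwise.\<close>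

definition mpow :: "complex^'n^'n \<Rightarrow> nat \<Rightarrow> complex^'n^'n"
  where "mpow C k = ((\<lambda>X. C ** X) ^^ k) (mat 1)"

definition Pstar :: "complex^'n^'n \<Rightarrow> complex^'n^'n \<Rightarrow> complex^'c^'n \<Rightarrow> complex^'c^'n"
  where "Pstar A B R = matrix_inv B ** A\<^sup>H ** R"

definition Pi_mat :: "complex^'n^'n \<Rightarrow> complex^'c^'n \<Rightarrow> complex^'c^'n \<Rightarrow> complex^'n^'n"
  where "Pi_mat A P R = P ** matrix_inv (R\<^sup>H ** A ** P) ** R\<^sup>H ** A"

definition E_plus ::
    "complex^'n^'n \<Rightarrow> complex^'n^'n \<Rightarrow> complex^'n^'n \<Rightarrow> complex^'c^'n \<Rightarrow> nat \<Rightarrow> nat \<Rightarrow> complex^'n^'n"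
  where "E_plus A M B R \<nu>\<^sub>1 \<nu>\<^sub>2 =
    mpow (mat 1 - badjoint B (matrix_inv M ** A)) \<nu>\<^sub>2
    ** (mat 1 - Pi_mat A (Pstar A B R) R)
    ** mpow (mat 1 - matrix_inv M ** A) \<nu>\<^sub>1"

definition Mhat_inv :: "complex^'n^'n \<Rightarrow> complex^'n^'n \<Rightarrow> complex^'n^'n \<Rightarrow> complex^'n^'n"
  where "Mhat_inv A M B =
    matrix_inv M ** A ** matrix_inv B
    + matrix_inv B ** A\<^sup>H ** (matrix_inv M)\<^sup>H
    - matrix_inv M ** A ** matrix_inv B ** A\<^sup>H ** (matrix_inv M)\<^sup>H"

definition Mhat :: "complex^'n^'n \<Rightarrow> complex^'n^'n \<Rightarrow> complex^'n^'n \<Rightarrow> complex^'n^'n"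
  where "Mhat A M B = matrix_inv (Mhat_inv A M B)"

definition K :: "complex^'n^'n \<Rightarrow> complex^'n^'n \<Rightarrow> complex^'c^'n \<Rightarrow> real"
  where "K G C P = (GREATEST r. \<exists>v. v \<noteq> 0 \<and>
    r = Re (sesq v (G ** (mat 1 - P ** matrix_inv (P\<^sup>H ** G ** P) ** P\<^sup>H ** G)) v)
        / Re (sesq v C v))"

end

theory Submission
  imports Defs
begin

text \<open>Write $T = I - M^{-1}A$, $Q = I - \Pi_A(P_*,R)$ and $S = \widehat M^{-1}B$; orthogonality,
  adjoints and norms refer to the inner product $\langle x,y\rangle_B = x^H B y$. Since
  $P_*^H B = R^H A$, the matrix $\Pi_A(P_*,R)$ is the orthogonal projection onto the range of $P_*$, so
  that $Q$ projects orthogonally onto $W = \{y \mid P_*^H B y = 0\}$.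

  The error propagation matrices are $E^{0,1} = T^+Q$, $E^{1,0} = QT = (E^{0,1})^+$ and
  $E^{1,1} = T^+QT = (E^{1,0})^+E^{1,0}$. The equalities between the norms are therefore
  $\|C^+\| = \|C\|$ (\<open>mnorm_badjoint\<close>) and $\|C^+C\| = \|C\|^2$ (\<open>mnorm_badjoint_mult_self\<close>).

  Both remaining quantities are expressed by the minimum $\mu$ of the Rayleigh quotient
  $\langle Sy,y\rangle_B / \langle y,y\rangle_B$ over $W \setminus \{0\}$, which exists by compactness
  (\<open>rayleigh_quotient_attains_min\<close>).

  Because $\|T^+y\|^2 = \langle TT^+y,y\rangle_B = \langle (I-S)y,y\rangle_B$, the square of the norm
  of $T^+$ on $W$ is $1-\mu$, and composing with the orthogonal projection $Q$ keeps this value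
  (\<open>mnorm_restricted_adjoint\<close>).

  On the other side $K_{\widehat M,B}(P_*) = 1/\mu$ (\<open>K_eq_inverse_minimum\<close>). Given $v$, let $z$ be
  its component $\widehat M$-orthogonal to the range of $P_*$ and put $u = B^{-1}\widehat M z$. Then
  $u \in W$, $Su = z$, and the numerator is
  $v^H\widehat M z = \langle v,u\rangle_B = \langle z,u\rangle_B = \langle Su,u\rangle_B \ge \mu\|u\|^2$;
  with Cauchy-Schwarz for $\langle v,u\rangle_B$ the numerator is at most $\|v\|^2/\mu$. Equality holds at
  $v = \mu y$ for a minimizer $y$ of the Rayleigh quotient, because stationarity gives $QSy = \mu y$.

  Finally $\mu > 0$ follows from $\|T\| < 1$, and $\mu < 1$ from $T^+y \ne 0$, which holds as
  $TT^+ = I - S$ is nonsingular.\<close>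

section \<open>Conjugate transposes and the form of a matrix\<close>

lemma ctranspose_mult: "(A ** B)\<^sup>H = B\<^sup>H ** A\<^sup>H"
  by (simp add: ctranspose_def vec_eq_iff matrix_matrix_mult_def transpose_def mult.commute)

lemma ctranspose_ctranspose [simp]: "(A\<^sup>H)\<^sup>H = A"
  by (simp add: ctranspose_def vec_eq_iff transpose_def)

lemma ctranspose_add: "(A + B)\<^sup>H = A\<^sup>H + B\<^sup>H"
  by (simp add: ctranspose_def vec_eq_iff transpose_def)

lemma ctranspose_diff: "(A - B)\<^sup>H = A\<^sup>H - B\<^sup>H"
  by (simp add: ctranspose_def vec_eq_iff transpose_def)

lemma ctranspose_mat_1 [simp]: "(mat 1)\<^sup>H = mat 1"
  by (auto simp: ctranspose_def vec_eq_iff transpose_def mat_def)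

lemma matrix_diff_ldistrib: "A ** (B - C) = A ** B - A ** (C :: 'a::ring_1^'n^'m)"
  by (simp add: vec_eq_iff matrix_matrix_mult_def sum_subtractf right_diff_distrib)

lemma matrix_diff_rdistrib: "(A - B) ** C = A ** C - B ** (C :: 'a::ring_1^'n^'m)"
  by (simp add: vec_eq_iff matrix_matrix_mult_def sum_subtractf left_diff_distrib)

lemma matrix_add_rdistrib: "(A + B) ** C = A ** C + B ** (C :: 'a::semiring_1^'n^'m)"
  by (simp add: vec_eq_iff matrix_matrix_mult_def sum.distrib distrib_right)

lemma invertible_iff_trivial_kernel:
  fixes A :: "'a::field^'n^'n"
  shows "invertible A \<longleftrightarrow> (\<forall>x. A *v x = 0 \<longrightarrow> x = 0)"
  by (simp add: invertible_left_inverse matrix_left_invertible_ker)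

lemma matrix_inv_left: "invertible A \<Longrightarrow> matrix_inv A ** A = mat 1"
  and matrix_inv_right: "invertible A \<Longrightarrow> A ** matrix_inv A = mat 1"
  for A :: "'a::field^'n^'n"
  unfolding invertible_def matrix_inv_def by (metis (mono_tags, lifting) someI_ex)+

lemma matrix_inv_mult_vec:
  fixes A :: "'a::field^'n^'n"
  assumes "invertible A"
  shows "matrix_inv A *v (A *v x) = x" and "A *v (matrix_inv A *v x) = x"
  by (simp_all add: assms matrix_vector_mul_assoc matrix_inv_left matrix_inv_right)

lemma invertible_matrix_inv: "invertible A \<Longrightarrow> invertible (matrix_inv A)"
  for A :: "'a::field^'n^'n"
  using matrix_inv_left matrix_inv_right invertible_def by blast

lemma matrix_inv_eqI:
  fixes A :: "'a::field^'n^'n"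
  assumes "X ** A = mat 1"
  shows "matrix_inv A = X"
proof -
  have "invertible A" using assms invertible_left_inverse by blast
  then have "X ** (A ** matrix_inv A) = X" by (simp add: matrix_inv_right)
  then show ?thesis by (simp add: matrix_mul_assoc assms)
qed

lemma ctranspose_matrix_inv:
  assumes "invertible (A :: complex^'n^'n)"
  shows "(matrix_inv A)\<^sup>H = matrix_inv (A\<^sup>H)"
  by (metis assms ctranspose_mat_1 ctranspose_mult matrix_inv_eqI matrix_inv_right)

lemma invertible_ctranspose:
  assumes "invertible (A :: complex^'n^'n)"
  shows "invertible (A\<^sup>H)"
  by (metis assms ctranspose_mat_1 ctranspose_mult invertible_left_inverse matrix_inv_right)

text \<open>The rank is defined through the rows, whose span here has full dimension; spanning rows give a
  left inverse.\<close>

lemma full_column_rank_injective: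
  fixes A :: "'a::field^'n^'m"
  assumes "rank A = CARD('n)" and "A *v x = 0"
  shows "x = 0"
proof -
  have "vec.dim (vec.span (rows A)) = vec.dim (UNIV :: ('a^'n) set)"
    using assms(1) by (simp add: row_rank_def_gen card_cart_basis)
  then have "vec.span (rows A) = UNIV"
    by (intro vec.subspace_dim_equal) (auto simp: vec.subspace_span)
  then show ?thesis
    using assms(2) matrix_left_invertible_span_rows_gen matrix_left_invertible_ker by blast
qed

lemma sesq_ctranspose: "sesq (C *v x) D y = sesq x (C\<^sup>H ** D) y"
proof -
  define w where "w = D *v y"
  have "(\<Sum>i\<in>UNIV. cnj ((C *v x) $ i) * w $ i)
      = (\<Sum>i\<in>UNIV. \<Sum>j\<in>UNIV. cnj (x $ j) * (cnj (C $ i $ j) * w $ i))"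
    by (simp add: matrix_vector_mult_def sum_distrib_right sum_distrib_left mult_ac)
  also have "\<dots> = (\<Sum>j\<in>UNIV. \<Sum>i\<in>UNIV. cnj (x $ j) * (cnj (C $ i $ j) * w $ i))"
    by (rule sum.swap)
  also have "\<dots> = (\<Sum>j\<in>UNIV. cnj (x $ j) * (C\<^sup>H *v w) $ j)"
    by (simp add: matrix_vector_mult_def sum_distrib_left ctranspose_def transpose_def)
  finally show ?thesis
    by (simp add: sesq_def w_def matrix_vector_mul_assoc)
qed

lemma sesq_mult_vec_right: "sesq x C (D *v y) = sesq x (C ** D) y"
  by (simp add: sesq_def matrix_vector_mul_assoc)

lemma cnj_sesq: "cnj (sesq x C y) = sesq y (C\<^sup>H) x"
proof -
  have "cnj (sesq x C y) = sesq (C *v y) (mat 1) x"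
    by (simp add: sesq_def mult.commute)
  then show ?thesis by (simp add: sesq_ctranspose)
qed

lemma matrix_vector_mult_scaleR_complex: "C *v (c *\<^sub>R x) = c *\<^sub>R (C *v x)"
  for C :: "complex^'n^'m"
  by (simp add: vec_eq_iff matrix_vector_mult_def scaleR_sum_right)

section \<open>The real inner product of a Hermitian positive definite matrix\<close>

text \<open>The real part of the form suffices for every estimate: it is a real inner product for Hermitian
  positive definite \<open>B\<close>, and it is bilinear over the reals. The rectangular type is needed for the
  intermediate forms that arise when a factor \<open>P\<close> is moved across.\<close>

definition binner :: "complex^'n^'m \<Rightarrow> complex^'m \<Rightarrow> complex^'n \<Rightarrow> real"
  where "binner B x y = Re (sesq x B y)"

lemma binner_add_left: "binner B (x + y) z = binner B x z + binner B y z"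
  and binner_diff_left: "binner B (x - y) z = binner B x z - binner B y z"
  by (simp_all add: binner_def sesq_def algebra_simps sum.distrib sum_subtractf)

lemma binner_add_right: "binner B x (y + z) = binner B x y + binner B x z"
  and binner_diff_right: "binner B x (y - z) = binner B x y - binner B x z"
  by (simp_all add: binner_def sesq_def algebra_simps sum.distrib sum_subtractf)

lemma binner_scaleR_left: "binner B (c *\<^sub>R x) y = c * binner B x y"
  by (simp add: binner_def sesq_def sum_distrib_left algebra_simps)

lemma binner_scaleR_right: "binner B x (c *\<^sub>R y) = c * binner B x y"
  by (simp add: binner_def sesq_def matrix_vector_mult_scaleR_complex sum_distrib_left
      algebra_simps)

lemma binner_zero_left [simp]: "binner B 0 y = 0"
  by (simp add: binner_def sesq_def)

lemma binner_zero_right [simp]: "binner B x 0 = 0"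
  by (simp add: binner_def sesq_def)

lemma binner_minus_right: "binner B x (- y) = - binner B x y"
  using binner_diff_right[of B x 0 y] by simp

lemmas binner_linear = binner_add_left binner_add_right binner_diff_left binner_diff_right
  binner_scaleR_left binner_scaleR_right

lemma binner_ctranspose: "binner B (C *v x) y = binner (C\<^sup>H ** B) x y"
  by (simp add: binner_def sesq_ctranspose)

lemma binner_mult_vec_right: "binner B x (C *v y) = binner (B ** C) x y"
  by (simp add: binner_def sesq_mult_vec_right)

lemma binner_swap: "binner C x y = binner (C\<^sup>H) y x"
  unfolding binner_def by (metis cnj_sesq complex_cnj(1) Re_complex_of_real cnj.simps(1))

lemma continuous_on_binner: "continuous_on S (\<lambda>x. binner B x (C *v x))"
  unfolding binner_def sesq_def matrix_vector_mult_def by (auto intro!: continuous_intros)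

lemma hpd_hermitian: "hpd B \<Longrightarrow> B\<^sup>H = B"
  by (simp add: hpd_def)

lemma binner_sym: "hpd B \<Longrightarrow> binner B x y = binner B y x"
  by (metis binner_swap hpd_hermitian)

lemma binner_pos: "hpd B \<Longrightarrow> x \<noteq> 0 \<Longrightarrow> 0 < binner B x x"
  by (simp add: hpd_def binner_def)

lemma binner_nonneg: "hpd B \<Longrightarrow> 0 \<le> binner B x x"
  by (cases "x = 0") (auto simp: binner_pos less_imp_le)

lemma binner_eq_0: "hpd B \<Longrightarrow> binner B x x = 0 \<longleftrightarrow> x = 0"
  by (cases "x = 0") (auto dest: binner_pos)

lemma vnorm_binner: "vnorm B x = sqrt (binner B x x)"
  by (simp add: vnorm_def binner_def)

lemma vnorm_square: "hpd B \<Longrightarrow> (vnorm B x)\<^sup>2 = binner B x x"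
  by (simp add: vnorm_binner binner_nonneg)

lemma vnorm_nonneg: "hpd B \<Longrightarrow> 0 \<le> vnorm B x"
  by (simp add: vnorm_binner binner_nonneg)

lemma vnorm_pos: "hpd B \<Longrightarrow> x \<noteq> 0 \<Longrightarrow> 0 < vnorm B x"
  by (simp add: vnorm_binner binner_pos)

text \<open>The usual discriminant argument, with the optimal coefficient multiplied by $y^H B y$ to avoid a
  division.\<close>

lemma binner_Cauchy_Schwarz_square:
  assumes "hpd B"
  shows "(binner B x y)\<^sup>2 \<le> binner B x x * binner B y y"
proof (cases "y = 0")
  case False
  let ?b = "binner B x y" and ?q = "binner B y y"
  have q: "0 < ?q" using assms False by (rule binner_pos)
  have "0 \<le> binner B (?q *\<^sub>R x - ?b *\<^sub>R y) (?q *\<^sub>R x - ?b *\<^sub>R y)"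
    using assms by (rule binner_nonneg)
  also have "\<dots> = ?q * (?q * binner B x x - ?b\<^sup>2)"
    by (simp add: binner_linear binner_sym[OF assms, of y x] power2_eq_square algebra_simps)
  finally show ?thesis using q by (simp add: zero_le_mult_iff mult.commute)
qed simp

lemma binner_Cauchy_Schwarz:
  assumes "hpd B"
  shows "binner B x y \<le> vnorm B x * vnorm B y"
proof -
  have "\<bar>binner B x y\<bar> \<le> sqrt (binner B x x * binner B y y)"
    using real_sqrt_le_mono[OF binner_Cauchy_Schwarz_square[OF assms, of x y]] by simp
  then show ?thesis by (simp add: vnorm_binner real_sqrt_mult)
qed

lemma hpd_invertible: "hpd B \<Longrightarrow> invertible B"
  by (force simp: invertible_iff_trivial_kernel hpd_def sesq_def)

lemma hpd_matrix_inv: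
  assumes "hpd B"
  shows "hpd (matrix_inv B)"
proof -
  note inv = hpd_invertible[OF assms]
  have herm: "(matrix_inv B)\<^sup>H = matrix_inv B"
    using ctranspose_matrix_inv[OF inv] hpd_hermitian[OF assms] by simp
  have "0 < binner (matrix_inv B) x x" if "x \<noteq> 0" for x
  proof -
    have "binner (matrix_inv B) x x = binner B (matrix_inv B *v x) (matrix_inv B *v x)"
      by (simp add: binner_ctranspose binner_mult_vec_right herm matrix_mul_assoc
          matrix_inv_left[OF inv])
    moreover have "matrix_inv B *v x \<noteq> 0"
      using that matrix_inv_mult_vec(2)[OF inv, of x] by auto
    ultimately show ?thesis using binner_pos[OF assms] by simp
  qed
  then show ?thesis using herm by (simp add: hpd_def binner_def)
qed

section \<open>Adjoints and operator norms\<close>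

lemma binner_badjoint:
  assumes "hpd B"
  shows "binner B (C *v x) y = binner B x (badjoint B C *v y)"
  by (simp add: binner_ctranspose binner_mult_vec_right badjoint_def matrix_mul_assoc
      matrix_inv_right[OF hpd_invertible[OF assms]])

lemma binner_badjoint':
  assumes "hpd B"
  shows "binner B (badjoint B C *v x) y = binner B x (C *v y)"
  by (metis assms binner_badjoint binner_sym)

lemma badjoint_mult:
  assumes "hpd B"
  shows "badjoint B (C ** D) = badjoint B D ** badjoint B C"
proof -
  have "badjoint B D ** badjoint B C = matrix_inv B ** D\<^sup>H ** (B ** matrix_inv B) ** C\<^sup>H ** B"
    by (simp add: badjoint_def matrix_mul_assoc)
  also have "\<dots> = badjoint B (C ** D)"
    by (simp add: badjoint_def matrix_mul_assoc ctranspose_mult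
        matrix_inv_right[OF hpd_invertible[OF assms]])
  finally show ?thesis ..
qed

lemma badjoint_diff: "badjoint B (C - D) = badjoint B C - badjoint B D"
  by (simp add: badjoint_def ctranspose_diff matrix_diff_ldistrib matrix_diff_rdistrib)

lemma badjoint_mat_1: "hpd B \<Longrightarrow> badjoint B (mat 1) = mat 1"
  by (simp add: badjoint_def matrix_inv_left hpd_invertible)

lemma badjoint_badjoint:
  assumes "hpd B"
  shows "badjoint B (badjoint B C) = C"
proof -
  note inv = hpd_invertible[OF assms]
  have "(matrix_inv B)\<^sup>H = matrix_inv B"
    by (simp add: hpd_hermitian hpd_matrix_inv assms)
  then have "badjoint B (badjoint B C) = (matrix_inv B ** B) ** C ** (matrix_inv B ** B)"
    using hpd_hermitian[OF assms] by (simp add: badjoint_def ctranspose_mult matrix_mul_assoc)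
  then show ?thesis by (simp add: matrix_inv_left[OF inv])
qed

text \<open>The Rayleigh quotient does not change under real scaling, so its infimum over a closed cone
  is its minimum over the compact Euclidean unit sphere of the cone.\<close>

lemma rayleigh_quotient_attains_min:
  fixes W :: "(complex^'n) set"
  assumes "hpd B" and "closed W" and scale: "\<And>c x. x \<in> W \<Longrightarrow> c *\<^sub>R x \<in> W"
    and "w\<^sub>0 \<in> W" and "w\<^sub>0 \<noteq> 0"
  obtains y \<mu> where "y \<in> W" "y \<noteq> 0" "binner B y (C *v y) = \<mu> * binner B y y"
    "\<And>w. w \<in> W \<Longrightarrow> \<mu> * binner B w w \<le> binner B w (C *v w)"
proof -
  define f where "f x = binner B x (C *v x) / binner B x x" for x
  let ?S = "W \<inter> sphere 0 1"
  have in_S: "(1 / norm w) *\<^sub>R w \<in> ?S" if "w \<in> W" "w \<noteq> 0" for w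
    using that scale by simp
  have "compact ?S" using assms(2) by (intro closed_Int_compact) auto
  moreover have "?S \<noteq> {}" using in_S[OF assms(4,5)] by blast
  moreover have "continuous_on ?S f"
    using continuous_on_binner[of ?S B C] continuous_on_binner[of ?S B "mat 1"]
    unfolding f_def
    by (intro continuous_on_divide) (auto simp: binner_eq_0[OF assms(1)])
  ultimately obtain y where y: "y \<in> ?S" and min: "\<And>x. x \<in> ?S \<Longrightarrow> f y \<le> f x"
    using continuous_attains_inf by metis
  have y0: "y \<noteq> 0" using y by auto
  have "f y * binner B w w \<le> binner B w (C *v w)" if "w \<in> W" for w
  proof (cases "w = 0")
    case False
    have "f y \<le> f ((1 / norm w) *\<^sub>R w)" using min in_S that False by blast
    also have "\<dots> = f w"
      using False by (simp add: f_def binner_linear matrix_vector_mult_scaleR_complex)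
    finally show ?thesis
      using binner_pos[OF assms(1) False] by (simp add: f_def pos_le_divide_eq)
  qed simp
  moreover have "binner B y (C *v y) = f y * binner B y y"
    using binner_eq_0[OF assms(1)] y0 by (simp add: f_def)
  ultimately show thesis using that y y0 by blast
qed

text \<open>The norm of a matrix is a supremum of reals, which is informative only for a set that is bounded
  above; this lemma provides the bound.\<close>

lemma vnorm_mult_vec_bounded:
  fixes B C :: "complex^'n^'n"
  assumes "hpd B"
  obtains k where "\<And>x. vnorm B (C *v x) \<le> k * vnorm B x"
proof -
  \<comment> \<open>The quotient of the squared norms is the Rayleigh quotient of \<open>C\<^sup>+ C\<close>, and its upper bound is
    a lower bound for that of \<open>- C\<^sup>+ C\<close>.\<close>
  define D where "D = - (badjoint B C ** C)"
  have D: "binner B x (D *v x) = - binner B (C *v x) (C *v x)" for x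
  proof -
    have "D *v x = - (badjoint B C *v (C *v x))"
      unfolding matrix_vector_mul_assoc
      by (simp add: D_def vec_eq_iff matrix_vector_mult_def sum_negf)
    then show ?thesis
      by (simp add: binner_minus_right binner_badjoint[OF assms])
  qed
  obtain \<mu> where mu: "\<And>x. \<mu> * binner B x x \<le> binner B x (D *v x)"
    using rayleigh_quotient_attains_min[OF assms closed_UNIV, of "axis undefined 1" D]
    by (auto simp: axis_eq_0_iff)
  have "vnorm B (C *v x) \<le> sqrt (- \<mu>) * vnorm B x" for x
    using mu[of x] D[of x] by (simp add: vnorm_binner flip: real_sqrt_mult)
  then show thesis by (rule that)
qed

lemma vnorm_mult_vec_le:
  assumes "hpd B"
  shows "vnorm B (C *v x) \<le> mnorm B C * vnorm B x"
proof (cases "x = 0")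
  case True
  then show ?thesis by (simp add: vnorm_binner)
next
  case False
  obtain k where k: "\<And>x. vnorm B (C *v x) \<le> k * vnorm B x"
    using vnorm_mult_vec_bounded[OF assms] by blast
  have "bdd_above ((\<lambda>x. vnorm B (C *v x) / vnorm B x) ` {x. x \<noteq> 0})"
    using k vnorm_pos[OF assms] by (auto intro!: bdd_aboveI[of _ k] simp: pos_divide_le_eq)
  then have "vnorm B (C *v x) / vnorm B x \<le> mnorm B C"
    unfolding mnorm_def using False by (intro cSUP_upper) auto
  then show ?thesis using vnorm_pos[OF assms False] by (simp add: pos_divide_le_eq)
qed

lemma mnorm_leI:
  fixes B C :: "complex^'n^'n"
  assumes "hpd B" and "\<And>x. vnorm B (C *v x) \<le> k * vnorm B x"
  shows "mnorm B C \<le> k"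
proof -
  have "axis undefined 1 \<in> {x :: complex^'n. x \<noteq> 0}" by (simp add: axis_eq_0_iff)
  then have "{x :: complex^'n. x \<noteq> 0} \<noteq> {}" by blast
  then show ?thesis
    unfolding mnorm_def using assms(2) vnorm_pos[OF assms(1)]
    by (intro cSUP_least) (auto simp: pos_divide_le_eq)
qed

lemma mnorm_nonneg:
  fixes B C :: "complex^'n^'n"
  assumes "hpd B"
  shows "0 \<le> mnorm B C"
proof -
  have "(axis undefined 1 :: complex^'n) \<noteq> 0" by (simp add: axis_eq_0_iff)
  from vnorm_pos[OF assms this] show ?thesis
    using order_trans[OF vnorm_nonneg[OF assms] vnorm_mult_vec_le[OF assms, of C "axis undefined 1"]]
    by (simp add: zero_le_mult_iff)
qed

lemma mnorm_square_leI:
  assumes "hpd B" and "\<And>x. binner B (C *v x) (C *v x) \<le> k * binner B x x" and "0 \<le> k"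
  shows "(mnorm B C)\<^sup>2 \<le> k"
proof -
  have "mnorm B C \<le> sqrt k"
    by (rule mnorm_leI[OF assms(1)])
      (simp add: assms vnorm_binner flip: real_sqrt_mult)
  then show ?thesis
    using mnorm_nonneg[OF assms(1)] assms(3) by (metis real_le_rsqrt real_sqrt_le_iff
        real_sqrt_pow2 power_mono)
qed

lemma binner_mult_vec_le:
  assumes "hpd B"
  shows "binner B (C *v x) (C *v x) \<le> (mnorm B C)\<^sup>2 * binner B x x"
  using power_mono[OF vnorm_mult_vec_le[OF assms, of C x] vnorm_nonneg[OF assms], of 2]
  by (simp add: power_mult_distrib vnorm_square[OF assms])

text \<open>From $\|C^+x\|^2 = \langle CC^+x,x\rangle_B \le \|C\|\,\|C^+x\|\,\|x\|$, cancelling a factor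
  $\|C^+x\|$.\<close>

lemma mnorm_badjoint_le:
  assumes "hpd B"
  shows "mnorm B (badjoint B C) \<le> mnorm B C"
proof (rule mnorm_leI[OF assms])
  fix x
  let ?y = "badjoint B C *v x"
  have "(vnorm B ?y)\<^sup>2 = binner B (C *v ?y) x"
    by (simp add: vnorm_square[OF assms] binner_badjoint[OF assms])
  also have "\<dots> \<le> vnorm B (C *v ?y) * vnorm B x" by (rule binner_Cauchy_Schwarz[OF assms])
  also have "\<dots> \<le> (mnorm B C * vnorm B ?y) * vnorm B x"
    by (intro mult_right_mono vnorm_mult_vec_le vnorm_nonneg assms)
  finally have "vnorm B ?y * vnorm B ?y \<le> vnorm B ?y * (mnorm B C * vnorm B x)"
    by (simp add: power2_eq_square mult_ac)
  then show "vnorm B ?y \<le> mnorm B C * vnorm B x"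
    using vnorm_nonneg[OF assms, of ?y] mnorm_nonneg[OF assms, of C] vnorm_nonneg[OF assms, of x]
    by (cases "vnorm B ?y = 0") auto
qed

lemma mnorm_badjoint: "hpd B \<Longrightarrow> mnorm B (badjoint B C) = mnorm B C"
  by (metis badjoint_badjoint mnorm_badjoint_le order_antisym)

text \<open>The C*-identity: one bound is submultiplicativity, the other is Cauchy-Schwarz in
  $\|Cx\|^2 = \langle C^+Cx,x\rangle_B$.\<close>

lemma mnorm_badjoint_mult_self:
  assumes "hpd B"
  shows "mnorm B (badjoint B C ** C) = (mnorm B C)\<^sup>2"
proof (rule antisym)
  show "mnorm B (badjoint B C ** C) \<le> (mnorm B C)\<^sup>2"
  proof (rule mnorm_leI[OF assms])
    fix x
    have "vnorm B (badjoint B C *v (C *v x)) \<le> mnorm B C * vnorm B (C *v x)"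
      using vnorm_mult_vec_le[OF assms, of "badjoint B C"] by (simp add: mnorm_badjoint[OF assms])
    also have "\<dots> \<le> mnorm B C * (mnorm B C * vnorm B x)"
      by (intro mult_left_mono vnorm_mult_vec_le mnorm_nonneg assms)
    finally show "vnorm B ((badjoint B C ** C) *v x) \<le> (mnorm B C)\<^sup>2 * vnorm B x"
      by (simp add: matrix_vector_mul_assoc power2_eq_square mult.assoc)
  qed
  show "(mnorm B C)\<^sup>2 \<le> mnorm B (badjoint B C ** C)"
  proof (rule mnorm_square_leI[OF assms _ mnorm_nonneg[OF assms]])
    fix x
    have "binner B (C *v x) (C *v x) = binner B x ((badjoint B C ** C) *v x)"
      by (simp add: binner_badjoint[OF assms] matrix_vector_mul_assoc)
    also have "\<dots> \<le> vnorm B x * vnorm B ((badjoint B C ** C) *v x)"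
      by (rule binner_Cauchy_Schwarz[OF assms])
    also have "\<dots> \<le> vnorm B x * (mnorm B (badjoint B C ** C) * vnorm B x)"
      by (intro mult_left_mono vnorm_mult_vec_le vnorm_nonneg assms)
    also have "\<dots> = mnorm B (badjoint B C ** C) * binner B x x"
      by (simp add: vnorm_square[OF assms, symmetric] power2_eq_square)
    finally show "binner B (C *v x) (C *v x) \<le> mnorm B (badjoint B C ** C) * binner B x x" .
  qed
qed

section \<open>Orthogonal projections onto the range of a matrix\<close>

text \<open>The projection is orthogonal for the inner product of \<open>G\<close>. Its two uses are \<open>G = B\<close>, which gives
  $\Pi_A(P_*,R)$, and $G = \widehat M$, which gives the projection inside $K_{\widehat M,B}$.\<close>

definition oproj :: "complex^'n^'n \<Rightarrow> complex^'c^'n \<Rightarrow> complex^'n^'n"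
  where "oproj G P = P ** matrix_inv (P\<^sup>H ** G ** P) ** P\<^sup>H ** G"

lemma gram_invertible:
  assumes "hpd G" and inj: "\<And>c. P *v c = 0 \<Longrightarrow> c = 0"
  shows "invertible (P\<^sup>H ** G ** P)"
  unfolding invertible_iff_trivial_kernel
proof (intro allI impI)
  fix c assume "(P\<^sup>H ** G ** P) *v c = 0"
  then have "binner (P\<^sup>H ** G ** P) c c = 0" by (simp add: binner_def sesq_def)
  then have "binner G (P *v c) (P *v c) = 0"
    by (simp add: binner_ctranspose binner_mult_vec_right matrix_mul_assoc)
  then show "c = 0" using binner_eq_0[OF assms(1)] inj by blast
qed

lemma oproj_in_range: obtains c where "oproj G P *v x = P *v c"
  by (metis oproj_def matrix_mul_assoc matrix_vector_mul_assoc)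

lemma oproj_residual:
  assumes "hpd G" and "\<And>c. P *v c = 0 \<Longrightarrow> c = 0"
  shows "(P\<^sup>H ** G) *v (x - oproj G P *v x) = 0"
proof -
  have "P\<^sup>H ** G ** oproj G P
      = (P\<^sup>H ** G ** P) ** matrix_inv (P\<^sup>H ** G ** P) ** (P\<^sup>H ** G)"
    by (simp add: oproj_def matrix_mul_assoc)
  then have "P\<^sup>H ** G ** oproj G P = P\<^sup>H ** G"
    by (simp add: matrix_inv_right gram_invertible assms)
  then show ?thesis by (simp add: matrix_vector_mult_diff_distrib matrix_vector_mul_assoc)
qed

lemma oproj_unique:
  assumes "hpd G" and "\<And>c. P *v c = 0 \<Longrightarrow> c = 0"
    and "(P\<^sup>H ** G) *v z = 0"
  shows "oproj G P *v (z + P *v c) = P *v c"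
proof -
  have "oproj G P *v z = (P ** matrix_inv (P\<^sup>H ** G ** P)) *v ((P\<^sup>H ** G) *v z)"
    by (simp add: oproj_def matrix_vector_mul_assoc matrix_mul_assoc)
  moreover have "oproj G P ** P = P ** (matrix_inv (P\<^sup>H ** G ** P) ** (P\<^sup>H ** G ** P))"
    by (simp add: oproj_def matrix_mul_assoc)
  ultimately show ?thesis
    by (simp add: assms matrix_vector_right_distrib matrix_vector_mul_assoc
        matrix_inv_left[OF gram_invertible[OF assms(1,2)]])
qed

lemma binner_range_orthogonal: "(P\<^sup>H ** B) *v y = 0 \<Longrightarrow> binner B (P *v c) y = 0"
  by (simp add: binner_ctranspose) (simp add: binner_def sesq_def)

section \<open>The constant K\<close>

text \<open>A polynomial $2at + bt^2$ that is nonnegative for all real $t$ has a minimum at $0$, where its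
  derivative is $2a$.\<close>

lemma linear_coefficient_zero:
  fixes a b :: real
  assumes "\<And>t. 0 \<le> 2 * t * a + t\<^sup>2 * b"
  shows "a = 0"
proof (rule ccontr)
  assume "a \<noteq> 0"
  \<comment> \<open>The point \<open>-a/s\<close> is so close to \<open>0\<close> that the linear term dominates; the added \<open>1\<close> makes \<open>s\<close>
    positive even for \<open>b = 0\<close>.\<close>
  define s where "s = \<bar>b\<bar> + 1"
  have s: "s > 0" "b < 2 * s" by (auto simp: s_def)
  have "2 * (- a / s) * a + (- a / s)\<^sup>2 * b = (a / s)\<^sup>2 * (b - 2 * s)"
    using s by (simp add: power2_eq_square field_simps)
  also have "\<dots> < 0"
    using s \<open>a \<noteq> 0\<close> by (intro mult_pos_neg) auto
  finally show False using assms[of "- a / s"] by simp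
qed

text \<open>A minimizer over a real subspace \<open>W\<close> is an eigenvector of the compression of \<open>C\<close> to \<open>W\<close>. This is the
  vanishing first variation of $\langle Cy,y\rangle_B - \mu\langle y,y\rangle_B$ in the direction
  \<open>w\<close>, and it replaces the spectral theorem in the evaluation of \<open>K\<close>.\<close>

lemma rayleigh_minimizer_stationary:
  assumes "hpd B" and adj: "\<And>u v. binner B (C *v u) v = binner B u (C *v v)"
    and add: "\<And>u v. u \<in> W \<Longrightarrow> v \<in> W \<Longrightarrow> u + v \<in> W"
    and scale: "\<And>c u. u \<in> W \<Longrightarrow> c *\<^sub>R u \<in> W"
    and "y \<in> W" and eq: "binner B y (C *v y) = \<mu> * binner B y y"
    and min: "\<And>w. w \<in> W \<Longrightarrow> \<mu> * binner B w w \<le> binner B w (C *v w)"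
    and "w \<in> W"
  shows "binner B w (C *v y - \<mu> *\<^sub>R y) = 0"
proof (rule linear_coefficient_zero)
  fix t :: real
  have "y + t *\<^sub>R w \<in> W" using assms by blast
  from min[OF this] have "0 \<le> binner B (y + t *\<^sub>R w) (C *v (y + t *\<^sub>R w))
      - \<mu> * binner B (y + t *\<^sub>R w) (y + t *\<^sub>R w)" by simp
  also have "\<dots> = 2 * t * binner B w (C *v y - \<mu> *\<^sub>R y)
      + t\<^sup>2 * (binner B w (C *v w) - \<mu> * binner B w w)"
    using adj[of y w] eq binner_sym[OF assms(1), of y w] binner_sym[OF assms(1), of w "C *v y"]
    by (simp add: matrix_vector_right_distrib matrix_vector_mult_scaleR_complex binner_linear
        power2_eq_square algebra_simps)
  finally show "0 \<le> 2 * t * binner B w (C *v y - \<mu> *\<^sub>R y)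
      + t\<^sup>2 * (binner B w (C *v w) - \<mu> * binner B w w)" .
qed

text \<open>Two different inner products occur in \<open>K\<close>. The substitution $u = B^{-1}Gz$ with $G = N^{-1}$, applied
  to a residual $z$ that is $G$-orthogonal to the range of \<open>P\<close>, yields a vector that is $B$-orthogonal to
  that range, and $z = NBu$. Thus the numerator of \<open>K\<close> becomes a quadratic form of $NB$ on the
  $B$-orthogonal complement, where the minimum \<open>\<mu>\<close> bounds it.\<close>

lemma K_eq_inverse_minimum:
  fixes B N :: "complex^'n^'n" and P :: "complex^'c^'n"
  assumes B: "hpd B" and N: "hpd N" and inj: "\<And>c. P *v c = 0 \<Longrightarrow> c = 0"
    and "0 < \<mu>" and "y \<noteq> 0" and y: "(P\<^sup>H ** B) *v y = 0"
    and eq: "binner B y ((N ** B) *v y) = \<mu> * binner B y y"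
    and min: "\<And>w. (P\<^sup>H ** B) *v w = 0 \<Longrightarrow> \<mu> * binner B w w \<le> binner B w ((N ** B) *v w)"
  shows "K (matrix_inv N) B P = 1 / \<mu>"
proof -
  define G where "G = matrix_inv N"
  have G: "hpd G" unfolding G_def by (rule hpd_matrix_inv[OF N])
  note invB = hpd_invertible[OF B] and invN = hpd_invertible[OF N]
  define num where "num v = binner (G ** (mat 1 - oproj G P)) v v" for v
  have num: "num v = binner B v u"
    if "B *v u = G *v (v - oproj G P *v v)" for u v
  proof -
    have "num v = binner G v (v - oproj G P *v v)"
      by (simp add: num_def binner_mult_vec_right[symmetric] matrix_vector_mult_diff_rdistrib)
    also have "\<dots> = binner B v u" using that by (simp add: binner_def sesq_def)
    finally show ?thesis .
  qed
  have upper: "num v \<le> binner B v v / \<mu>" for v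
  proof -
    define z where "z = v - oproj G P *v v"
    define u where "u = matrix_inv B *v (G *v z)"
    have Bu: "B *v u = G *v z" by (simp add: u_def matrix_inv_mult_vec invB)
    have u: "(P\<^sup>H ** B) *v u = 0"
      using oproj_residual[where P = P and x = v, OF G inj]
      by (simp add: Bu z_def flip: matrix_vector_mul_assoc)
    have Su: "(N ** B) *v u = z"
      by (simp add: Bu G_def matrix_inv_mult_vec invN flip: matrix_vector_mul_assoc)
    obtain c where c: "oproj G P *v v = P *v c" by (rule oproj_in_range)
    have "num v = binner B v u" using Bu by (intro num) (simp add: z_def)
    also have "\<dots> = binner B z u"
      using binner_range_orthogonal[OF u, of c] by (simp add: z_def c binner_linear)
    also have "\<dots> = binner B u ((N ** B) *v u)" by (simp add: Su binner_sym[OF B])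
    finally have le: "\<mu> * binner B u u \<le> num v" using min[OF u] by simp
    have cs: "(num v)\<^sup>2 \<le> binner B v v * binner B u u"
      using \<open>num v = binner B v u\<close> binner_Cauchy_Schwarz_square[OF B] by simp
    \<comment> \<open>Eliminating \<open>u\<close> from the two bounds leaves an inequality between \<open>num v\<close> and \<open>v\<close> alone.\<close>
    have "\<mu> * (num v)\<^sup>2 \<le> binner B v v * num v"
    proof -
      have "\<mu> * (num v)\<^sup>2 \<le> \<mu> * (binner B v v * binner B u u)"
        using cs \<open>0 < \<mu>\<close> by (intro mult_left_mono) auto
      also have "\<dots> = binner B v v * (\<mu> * binner B u u)" by simp
      also have "\<dots> \<le> binner B v v * num v"
        by (intro mult_left_mono le binner_nonneg[OF B])
      finally show ?thesis .
    qed
    then have "num v * (\<mu> * num v) \<le> num v * binner B v v"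
      by (simp add: power2_eq_square mult_ac)
    have "\<mu> * num v \<le> binner B v v"
    proof (cases "num v \<le> 0")
      case True
      then have "\<mu> * num v \<le> 0" using \<open>0 < \<mu>\<close> by (simp add: mult_le_0_iff)
      then show ?thesis using binner_nonneg[OF B] by (rule order_trans)
    next
      case False
      then show ?thesis
        using \<open>num v * (\<mu> * num v) \<le> num v * binner B v v\<close> by simp
    qed
    then show ?thesis
      using \<open>0 < \<mu>\<close> by (simp add: pos_le_divide_eq mult.commute)
  qed
  \<comment> \<open>The maximum is attained at \<open>\<mu> y\<close>: it differs from \<open>N B y\<close>, which is \<open>G\<close>-orthogonal to the range of
    \<open>P\<close>, by the vector \<open>d\<close> of that range, so \<open>N B y\<close> is its residual.\<close>
  have attained: "num (\<mu> *\<^sub>R y) = binner B (\<mu> *\<^sub>R y) (\<mu> *\<^sub>R y) / \<mu>"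
  proof -
    define d where "d = (N ** B) *v y - \<mu> *\<^sub>R y"
    obtain c where c: "oproj B P *v d = P *v c" by (rule oproj_in_range)
    define w where "w = d - P *v c"
    have w: "(P\<^sup>H ** B) *v w = 0"
      using oproj_residual[where P = P and x = d, OF B inj] by (simp add: w_def c)
    have adj: "binner B ((N ** B) *v u) v = binner B u ((N ** B) *v v)" for u v
      by (simp add: binner_ctranspose binner_mult_vec_right ctranspose_mult matrix_mul_assoc
          hpd_hermitian B N)
    have "binner B w d = 0"
      unfolding d_def
      by (rule rayleigh_minimizer_stationary[OF B adj, where W = "{w. (P\<^sup>H ** B) *v w = 0}"])
        (auto simp: y eq min w matrix_vector_right_distrib matrix_vector_mult_scaleR_complex)
    then have "binner B w w = 0"
      using binner_range_orthogonal[OF w, of c] binner_sym[OF B, of w "P *v c"]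
      by (simp add: w_def binner_linear)
    then have d: "d = P *v c" using binner_eq_0[OF B] by (simp add: w_def)
    define z where "z = (N ** B) *v y"
    have Gz: "G *v z = B *v y"
      by (simp add: z_def G_def matrix_inv_mult_vec invN flip: matrix_vector_mul_assoc)
    have "(P\<^sup>H ** G) *v z = 0" using y by (simp add: Gz flip: matrix_vector_mul_assoc)
    moreover have v: "\<mu> *\<^sub>R y = z + P *v (- c)"
    proof -
      have "P *v (- c) = - d" by (simp add: d vec_eq_iff matrix_vector_mult_def sum_negf)
      then show ?thesis by (simp add: z_def d_def)
    qed
    ultimately have "oproj G P *v (\<mu> *\<^sub>R y) = P *v (- c)"
      using oproj_unique[where P = P and z = z and c = "- c", OF G inj] by simp
    then have "num (\<mu> *\<^sub>R y) = binner B (\<mu> *\<^sub>R y) y"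
      using Gz by (intro num) (simp add: v)
    then show ?thesis using \<open>0 < \<mu>\<close> by (simp add: binner_linear)
  qed
  have "K G B P = (GREATEST r. \<exists>v. v \<noteq> 0 \<and> r = num v / binner B v v)"
    by (simp add: K_def num_def binner_def oproj_def)
  also have "\<dots> = 1 / \<mu>"
  proof (rule Greatest_equality)
    have v: "\<mu> *\<^sub>R y \<noteq> 0" using assms by simp
    then have "num (\<mu> *\<^sub>R y) / binner B (\<mu> *\<^sub>R y) (\<mu> *\<^sub>R y) = 1 / \<mu>"
      unfolding attained using binner_pos[OF B v] by simp
    then show "\<exists>v. v \<noteq> 0 \<and> 1 / \<mu> = num v / binner B v v"
      using v by metis
    fix r assume "\<exists>v. v \<noteq> 0 \<and> r = num v / binner B v v"
    then obtain v where "v \<noteq> 0" and r: "r = num v / binner B v v" by blast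
    then show "r \<le> 1 / \<mu>" using upper[of v] binner_pos[OF B \<open>v \<noteq> 0\<close>]
      by (simp add: pos_divide_le_eq)
  qed
  finally show ?thesis by (simp add: G_def)
qed

section \<open>The smoother\<close>

lemma Mhat_inv_hermitian:
  assumes "hpd B"
  shows "(Mhat_inv A M B)\<^sup>H = Mhat_inv A M B"
proof -
  have "(matrix_inv B)\<^sup>H = matrix_inv B"
    by (simp add: hpd_hermitian hpd_matrix_inv assms)
  then show ?thesis
    by (simp add: Mhat_inv_def ctranspose_add ctranspose_diff ctranspose_mult matrix_mul_assoc
        add.commute)
qed

lemma Mhat_inv_symmetrized_smoother:
  fixes A M B :: "complex^'n^'n"
  assumes "hpd B"
  shows "mat 1 - Mhat_inv A M B ** B
    = (mat 1 - matrix_inv M ** A) ** (mat 1 - badjoint B (matrix_inv M ** A))"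
proof -
  have *: "X ** matrix_inv B ** B = X" for X :: "complex^'n^'n"
    by (simp add: matrix_mul_assoc[symmetric] matrix_inv_left hpd_invertible assms)
  show ?thesis
    by (simp add: Mhat_inv_def badjoint_def ctranspose_mult matrix_diff_ldistrib
        matrix_diff_rdistrib matrix_add_rdistrib matrix_mul_assoc * algebra_simps)
qed

text \<open>The quadratic form of $\widehat M^{-1}B$ measures the decrease of the squared norm under $T^+$; this
  links the Rayleigh quotient to the norm of $T^+Q$.\<close>

lemma symmetrized_smoother_form:
  assumes "hpd B"
  shows "binner B y ((Mhat_inv A M B ** B) *v y) = binner B y y
    - binner B (badjoint B (mat 1 - matrix_inv M ** A) *v y)
        (badjoint B (mat 1 - matrix_inv M ** A) *v y)"
proof -
  let ?T = "mat 1 - matrix_inv M ** A"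
  have "Mhat_inv A M B ** B = mat 1 - ?T ** badjoint B ?T"
    using Mhat_inv_symmetrized_smoother[OF assms, of A M]
    by (simp add: badjoint_diff badjoint_mat_1[OF assms] algebra_simps)
  then show ?thesis
    by (simp add: matrix_vector_mult_diff_rdistrib binner_linear binner_badjoint'[OF assms]
        matrix_vector_mul_assoc)
qed

text \<open>With $x = By$ the form $x^H\widehat M^{-1}x$ is $\|y\|^2 - \|T^+y\|^2$, and $\|T^+\| = \|T\| < 1$.\<close>

lemma hpd_Mhat_inv:
  assumes B: "hpd B" and "mnorm B (mat 1 - matrix_inv M ** A) < 1"
  shows "hpd (Mhat_inv A M B)"
proof -
  let ?T = "mat 1 - matrix_inv M ** A" and ?N = "Mhat_inv A M B"
  note inv = hpd_invertible[OF B]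
  have "0 < binner ?N x x" if "x \<noteq> 0" for x
  proof -
    define y where "y = matrix_inv B *v x"
    have x: "x = B *v y" by (simp add: y_def matrix_inv_mult_vec inv)
    have "y \<noteq> 0" using that x by auto
    have "(mnorm B ?T)\<^sup>2 < 1"
      using assms(2) mnorm_nonneg[OF B, of ?T] by (simp add: abs_square_less_1)
    then have "(mnorm B ?T)\<^sup>2 * binner B y y < binner B y y"
      using binner_pos[OF B \<open>y \<noteq> 0\<close>] by simp
    then have "0 < binner B y ((?N ** B) *v y)"
      using binner_mult_vec_le[OF B, of "badjoint B ?T" y]
      by (simp add: symmetrized_smoother_form[OF B] mnorm_badjoint[OF B])
    also have "\<dots> = binner ?N x x"
      by (simp add: x binner_ctranspose binner_mult_vec_right matrix_mul_assoc hpd_hermitian[OF B])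
    finally show ?thesis .
  qed
  then show ?thesis by (simp add: hpd_def binner_def Mhat_inv_hermitian[OF B])
qed

section \<open>The convergence factor\<close>

lemma mpow_0 [simp]: "mpow C 0 = mat 1" and mpow_1 [simp]: "mpow C (Suc 0) = C"
  by (simp_all add: mpow_def)

lemma range_dim_less_imp_kernel:
  fixes C :: "complex^'n^'n"
  assumes "range_dim C < CARD('n)"
  obtains y where "y \<noteq> 0" "C *v y = 0"
proof -
  have "\<not> invertible C"
  proof
    assume "invertible C"
    then have "surj ((*v) C)" by (metis matrix_inv_mult_vec(2) surjI)
    then show False using assms by (simp add: range_dim_def card_cart_basis)
  qed
  then show thesis using that by (auto simp: invertible_iff_trivial_kernel)
qed

text \<open>The choice of $P_*$ makes $P_*^H B = R^H A$, which turns the oblique-looking formula for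
  $\Pi_A(P_*,R)$ into that of an orthogonal projection.\<close>

lemma Pi_mat_Pstar:
  assumes "hpd B"
  shows "Pi_mat A (Pstar A B R) R = oproj B (Pstar A B R)"
proof -
  have "(matrix_inv B)\<^sup>H = matrix_inv B"
    by (simp add: hpd_hermitian hpd_matrix_inv assms)
  then have "(Pstar A B R)\<^sup>H ** B = R\<^sup>H ** A"
    by (simp add: Pstar_def ctranspose_mult matrix_mul_assoc[symmetric] matrix_inv_left
        hpd_invertible assms)
  then show ?thesis
    unfolding Pi_mat_def oproj_def by (metis matrix_mul_assoc)
qed

lemma Pstar_injective:
  assumes "hpd B" and "invertible A" and "rank R = CARD('c)"
    and "Pstar A B (R :: complex^'c^'n) *v c = 0"
  shows "c = 0"
proof -
  have "invertible (matrix_inv B)" "invertible (A\<^sup>H)"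
    using assms by (simp_all add: invertible_matrix_inv hpd_invertible invertible_ctranspose)
  moreover have "matrix_inv B *v (A\<^sup>H *v (R *v c)) = 0"
    using assms(4) by (simp add: Pstar_def matrix_vector_mul_assoc matrix_mul_assoc)
  ultimately have "R *v c = 0" unfolding invertible_iff_trivial_kernel by blast
  then show ?thesis using full_column_rank_injective assms(3) by blast
qed

text \<open>An orthogonal projection \<open>Q\<close> does not increase the norm, so the supremum of
  $\|DQx\|/\|x\|$ is already reached on the range of \<open>Q\<close>.\<close>

lemma mnorm_restricted_adjoint:
  assumes B: "hpd B" and Q: "Q ** Q = Q" "badjoint B Q = Q"
    and "y \<noteq> 0" and y: "Q *v y = y"
    and eq: "binner B (D *v y) (D *v y) = k * binner B y y"
    and max: "\<And>w. Q *v w = w \<Longrightarrow> binner B (D *v w) (D *v w) \<le> k * binner B w w"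
  shows "(mnorm B (D ** Q))\<^sup>2 = k"
proof (rule antisym)
  have ypos: "0 < binner B y y" using B \<open>y \<noteq> 0\<close> by (rule binner_pos)
  have "0 \<le> k * binner B y y" using eq binner_nonneg[OF B] by metis
  then have k: "0 \<le> k" using ypos by (simp add: zero_le_mult_iff)
  show "(mnorm B (D ** Q))\<^sup>2 \<le> k"
  proof (rule mnorm_square_leI[OF B _ k])
    fix x
    have "0 \<le> binner B (x - Q *v x) (x - Q *v x)" using B by (rule binner_nonneg)
    also have "\<dots> = binner B x x - binner B (Q *v x) (Q *v x)"
      using binner_badjoint[OF B, of Q x x] binner_badjoint[OF B, of Q x "Q *v x"]
        binner_sym[OF B, of x "Q *v x"]
      by (simp add: binner_linear Q matrix_vector_mul_assoc)
    finally have "k * binner B (Q *v x) (Q *v x) \<le> k * binner B x x"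
      using k by (simp add: mult_left_mono)
    then show "binner B ((D ** Q) *v x) ((D ** Q) *v x) \<le> k * binner B x x"
      using max[of "Q *v x"] Q by (simp add: matrix_vector_mul_assoc)
  qed
  have "k * binner B y y \<le> (mnorm B (D ** Q))\<^sup>2 * binner B y y"
    using binner_mult_vec_le[OF B, of "D ** Q" y] eq y
    by (simp flip: matrix_vector_mul_assoc)
  then show "k \<le> (mnorm B (D ** Q))\<^sup>2" using ypos by simp
qed

theorem theorem3p18:
  fixes A M B :: "complex^'n^'n" and R :: "complex^'c^'n"
  assumes "invertible A" and "invertible M" and "hpd B"
    and "rank R = CARD('c)"
    and "mnorm B (mat 1 - matrix_inv M ** A) < 1"
    and "invertible (mat 1 - Mhat_inv A M B ** B)"
    and "projection (Pi_mat A (Pstar A B R) R)"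
    and "b_orthogonal B (Pi_mat A (Pstar A B R) R)"
    and "0 < range_dim (Pi_mat A (Pstar A B R) R)"
    and "range_dim (Pi_mat A (Pstar A B R) R) = CARD('c)"
    and "CARD('c) < CARD('n)"
  shows "mnorm B (E_plus A M B R 1 1) = (mnorm B (E_plus A M B R 1 0))\<^sup>2 \<and>
    (mnorm B (E_plus A M B R 1 0))\<^sup>2 = (mnorm B (E_plus A M B R 0 1))\<^sup>2 \<and>
    (mnorm B (E_plus A M B R 0 1))\<^sup>2 = 1 - 1 / K (Mhat A M B) B (Pstar A B R) \<and>
    1 / K (Mhat A M B) B (Pstar A B R) \<in> {0<..<1}"
proof -
  note B = \<open>hpd B\<close>
  define P where "P = Pstar A B R"
  define Q where "Q = mat 1 - Pi_mat A P R"
  define T where "T = mat 1 - matrix_inv M ** A"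
  define S where "S = Mhat_inv A M B ** B"
  define W where "W = {y. (P\<^sup>H ** B) *v y = 0}"
  have inj: "c = 0" if "P *v c = 0" for c
    using Pstar_injective assms(1,3,4) that unfolding P_def by blast
  have Pi: "Pi_mat A P R = oproj B P" unfolding P_def by (rule Pi_mat_Pstar[OF B])
  have Qv: "Q *v x = x - oproj B P *v x" for x
    by (simp add: Q_def Pi matrix_vector_mult_diff_rdistrib)
  have QQ: "Q ** Q = Q"
    using assms(7)
    by (simp add: Q_def P_def projection_def matrix_diff_ldistrib matrix_diff_rdistrib)
  have Q_adj: "badjoint B Q = Q"
    using assms(8) by (simp add: Q_def P_def b_orthogonal_def badjoint_diff badjoint_mat_1[OF B])
  have W: "y \<in> W \<longleftrightarrow> Q *v y = y" for y
  proof
    assume "y \<in> W"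
    then show "Q *v y = y"
      using oproj_unique[where P = P and z = y and c = 0, OF B inj] by (simp add: Qv W_def)
  next
    assume "Q *v y = y"
    then show "y \<in> W" using oproj_residual[where P = P and x = y, OF B inj] by (simp add: Qv W_def)
  qed

  have T_adj: "badjoint B T = mat 1 - badjoint B (matrix_inv M ** A)"
    by (simp add: T_def badjoint_diff badjoint_mat_1[OF B])
  have E01: "E_plus A M B R 0 1 = badjoint B T ** Q"
    and E10: "E_plus A M B R 1 0 = Q ** T"
    and "E_plus A M B R 1 1 = badjoint B T ** Q ** T"
    by (simp_all add: E_plus_def T_adj[symmetric] T_def[symmetric] Q_def P_def)
  then have E11: "E_plus A M B R 1 1 = badjoint B (Q ** T) ** (Q ** T)"
    by (metis badjoint_mult[OF B] Q_adj QQ matrix_mul_assoc)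
  have E10': "E_plus A M B R 1 0 = badjoint B (badjoint B T ** Q)"
    unfolding E10 by (simp add: badjoint_mult[OF B] badjoint_badjoint[OF B] Q_adj)

  have S: "binner B w (S *v w)
      = binner B w w - binner B (badjoint B T *v w) (badjoint B T *v w)" for w
    unfolding S_def T_def by (rule symmetrized_smoother_form[OF B])
  have N: "hpd (Mhat_inv A M B)" by (rule hpd_Mhat_inv[OF B assms(5)])

  \<comment> \<open>The coarse space is proper, so \<open>W\<close> contains a nonzero vector and the minimum is taken over a
    nonempty set.\<close>
  obtain w0 where w0: "w0 \<noteq> 0" "oproj B P *v w0 = 0"
    using range_dim_less_imp_kernel assms(10,11) Pi unfolding P_def by metis
  have "closed W"
  proof -
    have "W = {y. (P\<^sup>H ** B) *v y \<in> {0}}" by (simp add: W_def)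
    moreover have "closed ((\<lambda>y. (P\<^sup>H ** B) *v y) -` {0})"
      by (intro closed_vimage) (auto simp: matrix_vector_mult_def intro!: continuous_intros)
    ultimately show ?thesis by (simp add: vimage_def)
  qed
  moreover have "c *\<^sub>R x \<in> W" if "x \<in> W" for c x
    using that by (simp add: W_def matrix_vector_mult_scaleR_complex)
  moreover have "w0 \<in> W" using w0 by (simp add: W Qv)
  ultimately obtain y \<mu> where y: "y \<in> W" "y \<noteq> 0"
    and eq: "binner B y (S *v y) = \<mu> * binner B y y"
    and min: "\<And>w. w \<in> W \<Longrightarrow> \<mu> * binner B w w \<le> binner B w (S *v w)"
    using rayleigh_quotient_attains_min[OF B _ _ _ w0(1)] by metis
  have ypos: "0 < binner B y y" using B y(2) by (rule binner_pos)

  have "0 < \<mu>"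
  proof -
    have "B *v y \<noteq> 0" using hpd_invertible[OF B] y(2) invertible_iff_trivial_kernel by blast
    then have "0 < binner (Mhat_inv A M B) (B *v y) (B *v y)" by (rule binner_pos[OF N])
    then have "0 < binner B y (S *v y)"
      by (simp add: S_def binner_ctranspose binner_mult_vec_right matrix_mul_assoc
          hpd_hermitian[OF B])
    then show ?thesis using eq ypos by (simp add: zero_less_mult_iff)
  qed
  have "\<mu> < 1"
  proof -
    have "mat 1 - S = T ** badjoint B T"
      unfolding S_def T_adj unfolding T_def by (rule Mhat_inv_symmetrized_smoother[OF B])
    then have "T *v (badjoint B T *v y) \<noteq> 0"
      using assms(6) y(2) invertible_iff_trivial_kernel
      by (metis S_def matrix_vector_mul_assoc)
    then have "badjoint B T *v y \<noteq> 0" by auto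
    then have "0 < binner B (badjoint B T *v y) (badjoint B T *v y)" by (rule binner_pos[OF B])
    then have "\<mu> * binner B y y < 1 * binner B y y" using eq S[of y] by simp
    then show ?thesis using ypos by simp
  qed

  have K: "K (Mhat A M B) B P = 1 / \<mu>"
    unfolding Mhat_def
    by (rule K_eq_inverse_minimum[OF B N inj \<open>0 < \<mu>\<close> y(2)])
      (use y eq min in \<open>auto simp: W_def S_def\<close>)
  have norm: "(mnorm B (badjoint B T ** Q))\<^sup>2 = 1 - \<mu>"
  proof (rule mnorm_restricted_adjoint[OF B QQ Q_adj y(2)])
    show "Q *v y = y" using y W by blast
    show "binner B (badjoint B T *v y) (badjoint B T *v y) = (1 - \<mu>) * binner B y y"
      using eq S[of y] by (simp add: algebra_simps)
    show "binner B (badjoint B T *v w) (badjoint B T *v w) \<le> (1 - \<mu>) * binner B w w"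
      if "Q *v w = w" for w
      using min[of w] S[of w] that W by (simp add: algebra_simps)
  qed
  have "mnorm B (E_plus A M B R 1 1) = (mnorm B (E_plus A M B R 1 0))\<^sup>2"
    unfolding E11 E10 by (rule mnorm_badjoint_mult_self[OF B])
  moreover have "mnorm B (E_plus A M B R 1 0) = mnorm B (E_plus A M B R 0 1)"
    unfolding E10' E01 by (rule mnorm_badjoint[OF B])
  ultimately show ?thesis
    using norm K \<open>0 < \<mu>\<close> \<open>\<mu> < 1\<close> unfolding E01 P_def by simp
qed

end
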